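(* Let $n\ge 2$, let $a_i>0$, $b_i>0$ for $1\le i\le n$, let $\mathbf X=(X_1,\dots,X_n)$ have ordered beta distribution with parameters $\{a_i\}_{1\le i\le n}$ and $\{b_i\}_{1\le i\le n}$, and let $C=\mathrm B\Big(\begin{matrix} a_1,\dots,a_n\\ b_1,\dots,b_n\end{matrix}\Big)$. Then the following statements are true. (i) The random vector $\hat{\mathbf X}:=(1-X_n,1-X_{n-1},\dots,1-X_1)$ has ordered beta distribution with parameters $(b_n,b_{n-1},\dots,b_1)$ and $(a_n,a_{n-1},\dots,a_1)$ (the first vector playing the role of the $a$-parameters, the second of the $b$-parameters). (ii) For $1\le k\le n-1$ and $z\in(0,1)$, $$\mathbb P(X_k\le z<X_{k+1})=C^{-1}\,\mathrm B\Big(\begin{matrix} a_1,\dots,a_k\\ b_1,\dots,b_k\end{matrix}\Big\vert z\Big)\,\mathrm B\Big(\begin{matrix} b_n,b_{n-1},\dots,b_{k+1}\\ a_n,a_{n-1},\dots,a_{k+1}\end{matrix}\Big\vert 1-z\Big).$$ (iii) For $1\le k\le n$, the random variable $X_k$ has a density on $(0,1)$ given by $$\mathbb P(X_k\in \mathrm dx)=C^{-1}x^{a_k-1}(1-x)^{b_k-1}\,\mathrm B\Big(\begin{matrix} a_1,\dots,a_{k-1}\\ b_1,\dots,b_{k-1}\end{matrix}\Big\vert x\Big)\,\mathrm B\Big(\begin{matrix} b_n,b_{n-1},\dots,b_{k+1}\\ a_n,a_{n-1},\dots,a_{k+1}\end{matrix}\Big\vert 1-x\Big)\,\mathrm dx,\qquad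 x\in(0,1).$$ (iv) For $1\le k\le n$ and $z\in[0,1]$, $$\mathbb P(X_k\le z)=\sum_{j=k}^{n}C^{-1}\,\mathrm B\Big(\begin{matrix} a_1,\dots,a_j\\ b_1,\dots,b_j\end{matrix}\Big\vert z\Big)\,\mathrm B\Big(\begin{matrix} b_n,b_{n-1},\dots,b_{j+1}\\ a_n,a_{n-1},\dots,a_{j+1}\end{matrix}\Big\vert 1-z\Big)$$ and $$\mathbb P(z<X_k)=\sum_{j=0}^{k-1}C^{-1}\,\mathrm B\Big(\begin{matrix} a_1,\dots,a_j\\ b_1,\dots,b_j\end{matrix}\Big\vert z\Big)\,\mathrm B\Big(\begin{matrix} b_n,b_{n-1},\dots,b_{j+1}\\ a_n,a_{n-1},\dots,a_{j+1}\end{matrix}\Big\vert 1-z\Big).$$ (v) If $1\le k\le n$, $\alpha>-a_k$ and $\beta>-b_k$, then $$\mathbb E[X_k^{\alpha}(1-X_k)^{\beta}]=C^{-1}\,\mathrm B\Big(\begin{matrix} a_1,\dots,a_k+\alpha,\dots,a_n\\ b_1,\dots,b_k+\beta,\dots,b_n\end{matrix}\Big),$$ and, more generally, if $\alpha_i>-a_i$ and $\beta_i>-b_i$ for $i=1,\dots,n$, then $$\mathbb E\Big[\prod_{i=1}^nX_i^{\alpha_i}(1-X_i)^{\beta_i}\Big]=C^{-1}\,\mathrm B\Big(\begin{matrix} a_1+\alpha_1,\dots,a_n+\alpha_n\\ b_1+\beta_1,\dots,b_n+\beta_n\end{matrix}\Big).$$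
   Context: Ordered beta distribution: for $n\in\mathbb N$ and $a_i>0$, $b_i>0$ ($1\le i\le n$), a random vector $\mathbf X=(X_1,\dots,X_n)$ has ordered beta distribution with parameters $\{a_i\}$ and $\{b_i\}$ if $$\mathbb P(X_1\in\mathrm dx_1,\dots,X_n\in\mathrm dx_n)=K^{-1}\,\mathbf 1_{\{0\le x_1\le x_2\le\cdots\le x_n\le1\}}\prod_{i=1}^nx_i^{a_i-1}(1-x_i)^{b_i-1}\,\mathrm dx_i,$$ where $K$ is the normalization constant. Generalized incomplete beta function: for $m\in\mathbb N$, $a_i>0$, $b_i>0$ ($1\le i\le m$) and $z\in[0,1]$, $$\mathrm B\Big(\begin{matrix} a_1,\dots,a_m\\ b_1,\dots,b_m\end{matrix}\Big\vert z\Big)=\int\mathbf 1_{\{0\le x_1\le x_2\le\dots\le x_m\le z\}}\prod_{i=1}^mx_i^{a_i-1}(1-x_i)^{b_i-1}\,\mathrm dx_1\cdots\mathrm dx_m .$$ The generalized beta function is its value at $z=1$: $\mathrm B\Big(\begin{matrix} a_1,\dots,a_m\\ b_1,\dots,b_m\end{matrix}\Big):=\mathrm B\Big(\begin{matrix} a_1,\dots,a_m\\ b_1,\dots,b_m\end{matrix}\Big\vert 1\Big)$. Convention: with empty parameter lists ($m=0$), $\mathrm B\Big(\begin{matrix}-\\-\end{matrix}\Big\vert z\Big)=1$ for all $z$. In particular the parameter list $a_1,\dots,a_j$ is empty for $j=0$, and $b_n,\dots,b_{j+1}$ is empty for $j=n$. *)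

theory Defs
  imports "HOL-Probability.Probability"
begin

text \<open>
  Vectors of length \<open>m\<close> are functions on the index set \<open>{1..m}\<close>, and \<open>dx\<^sub>1 \<dots> dx\<^sub>m\<close> is the product
  measure \<open>Pi\<^sub>M {1..m} (\<lambda>_. lborel)\<close>. Powers with real exponents are \<open>powr\<close>; since \<open>0 powr c = 0\<close>
  for every \<open>c\<close>, the kernel below differs from the usual one only where some \<open>x i\<close> is \<open>0\<close> or \<open>1\<close>,
  which is a null set.
\<close>

text \<open>The chain \<open>0 \<le> x 1 \<le> \<dots> \<le> x m \<le> z\<close>, written so that it is vacuously true for \<open>m = 0\<close>.\<close>

definition ordered_region :: "nat \<Rightarrow> real \<Rightarrow> (nat \<Rightarrow> real) set" where
  "ordered_region m z =
     {x. (\<forall>i\<in>{1..m}. 0 \<le> x i \<and> x i \<le> z) \<and> (\<forall>i\<in>{1..<m}. x i \<le> x (Suc i))}"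

definition ordered_beta_kernel ::
    "nat \<Rightarrow> (nat \<Rightarrow> real) \<Rightarrow> (nat \<Rightarrow> real) \<Rightarrow> real \<Rightarrow> (nat \<Rightarrow> real) \<Rightarrow> real" where
  "ordered_beta_kernel m a b z x =
     indicator (ordered_region m z) x * (\<Prod>i=1..m. x i powr (a i - 1) * (1 - x i) powr (b i - 1))"

definition gen_inc_beta :: "nat \<Rightarrow> (nat \<Rightarrow> real) \<Rightarrow> (nat \<Rightarrow> real) \<Rightarrow> real \<Rightarrow> real" where
  "gen_inc_beta m a b z =
     (\<integral>x. ordered_beta_kernel m a b z x \<partial>(\<Pi>\<^sub>M i\<in>{1..m}. lborel))"

definition gen_beta :: "nat \<Rightarrow> (nat \<Rightarrow> real) \<Rightarrow> (nat \<Rightarrow> real) \<Rightarrow> real" where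
  "gen_beta m a b = gen_inc_beta m a b 1"

text \<open>The convention for empty parameter lists is a consequence of the definition.\<close>

lemma gen_inc_beta_0: "gen_inc_beta 0 a b z = 1"
  by (simp add: gen_inc_beta_def ordered_beta_kernel_def ordered_region_def PiM_empty
      lebesgue_integral_count_space_finite)

text \<open>
  \<open>X i\<close> is the \<open>i\<close>-th coordinate of the random vector; the normalization constant is the
  integral of the kernel at \<open>z = 1\<close>, i.e. \<open>gen_beta n a b\<close>.
\<close>

definition has_ordered_beta ::
    "'s measure \<Rightarrow> nat \<Rightarrow> (nat \<Rightarrow> real) \<Rightarrow> (nat \<Rightarrow> real) \<Rightarrow> (nat \<Rightarrow> 's \<Rightarrow> real) \<Rightarrow> bool" where
  "has_ordered_beta M n a b X \<longleftrightarrow>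
     distributed M (\<Pi>\<^sub>M i\<in>{1..n}. lborel) (\<lambda>\<omega>. \<lambda>i\<in>{1..n}. X i \<omega>)
       (\<lambda>x. ennreal (inverse (gen_beta n a b) * ordered_beta_kernel n a b 1 x))"

text \<open>
  For \<open>c\<close> indexed by \<open>{1..n}\<close>, \<open>rev_idx n c\<close> is \<open>c n, c (n - 1), \<dots>, c 1\<close>; its first \<open>n - k\<close>
  entries are \<open>c n, \<dots>, c (k + 1)\<close>.
\<close>

definition rev_idx :: "nat \<Rightarrow> (nat \<Rightarrow> 'c) \<Rightarrow> nat \<Rightarrow> 'c" where
  "rev_idx n c i = c (n + 1 - i)"

end

(*
  Everything follows from splitting the ordered kernel. On the event that exactly the first k
  coordinates are at most z, the region 0 <= x_1 <= ... <= x_n <= 1 is the product of the chain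
  0 <= x_1 <= ... <= x_k <= z and the chain z <= x_{k+1} <= ... <= x_n <= 1, and the reflection
  x_i -> 1 - x_{n+1-i}, which preserves Lebesgue measure and interchanges the roles of the
  a- and b-parameters, turns the second chain into an ordinary one of length n - k below 1 - z.
  Fixing x_k = z instead splits the region in the same way and gives the density of X_k.
  Almost surely exactly one of the n + 1 events "precisely j coordinates are at most z" occurs,
  which yields the distribution functions. For the moments, the extra factors merely shift the
  parameters of the kernel.
*)
theory Submission imports Defs begin

section \<open>Order, measurability and finiteness of the kernel\<close>

abbreviation lborel_on :: "nat set \<Rightarrow> (nat \<Rightarrow> real) measure" where
  "lborel_on I \<equiv> Pi\<^sub>M I (\<lambda>_. lborel)"

lemma measurable_lborel_on_component:
  assumes "i \<in> I"
  shows "(\<lambda>x. x i) \<in> borel_measurable (lborel_on I)"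
  using measurable_component_singleton[OF assms, where M = "\<lambda>_. lborel :: real measure"] by simp

text \<open>The reflection refers to the full length \<open>n\<close> throughout. At the indices
  \<open>{1..n-k}\<close> it reads exactly the coordinates in \<open>{k+1..n}\<close>, so one map
  serves the tails of all lengths and matches \<open>rev_idx n\<close>.\<close>

definition reflect :: "nat \<Rightarrow> (nat \<Rightarrow> real) \<Rightarrow> nat \<Rightarrow> real" where
  "reflect n x i = 1 - x (n + 1 - i)"

text \<open>Neighbouring inequalities chain by induction. The \<open>mono_on\<close> form restricts
  to index subintervals, glues along a level and is compatible with index reversal.\<close>

lemma ordered_region_iff_mono_on:
  "x \<in> ordered_region m z \<longleftrightarrow> (\<forall>i\<in>{1..m}. 0 \<le> x i \<and> x i \<le> z) \<and> mono_on {1..m} x"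
proof -
  have "mono_on {1..m} x" if step: "\<forall>i\<in>{1..<m}. x i \<le> x (Suc i)"
  proof (rule mono_onI)
    fix r s assume "r \<in> {1..m}" "s \<in> {1..m}" "r \<le> s"
    from \<open>r \<le> s\<close> \<open>s \<in> {1..m}\<close> show "x r \<le> x s"
    proof (induction s rule: dec_induct)
      case (step i)
      then show ?case using that \<open>r \<in> {1..m}\<close> by (force intro: order_trans)
    qed simp
  qed
  then show ?thesis by (auto simp: ordered_region_def mono_on_def)
qed

lemma ordered_beta_kernel_nonneg: "0 \<le> ordered_beta_kernel m a b z x"
  by (simp add: ordered_beta_kernel_def prod_nonneg)

text \<open>Points of a product space are extensional, whereas reflected or updated points need not
  be. This lemma inserts and removes \<open>restrict\<close> and updates outside
  \<open>{1..m}\<close>.\<close>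

lemma ordered_beta_kernel_cong:
  assumes "\<And>i. i \<in> {1..m} \<Longrightarrow> x i = y i"
  shows "ordered_beta_kernel m a b z x = ordered_beta_kernel m a b z y"
proof -
  have "x \<in> ordered_region m z \<longleftrightarrow> y \<in> ordered_region m z"
    using assms unfolding ordered_region_def by auto
  then show ?thesis
    using assms by (auto simp: ordered_beta_kernel_def indicator_def intro!: prod.cong)
qed

lemma gen_inc_beta_nonneg: "0 \<le> gen_inc_beta m a b z"
  unfolding gen_inc_beta_def by (intro Bochner_Integration.integral_nonneg ordered_beta_kernel_nonneg)

text \<open>Measurability is joint in the level and the point because the level becomes an
  integration variable in the density of a single coordinate.\<close>

lemma measurable_ordered_beta_kernel_pair:
  "(\<lambda>(z, x). ordered_beta_kernel m a b z x)
     \<in> borel_measurable (borel \<Otimes>\<^sub>M lborel_on {1..m})"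
proof -
  have eq: "(\<lambda>(z, x). ordered_beta_kernel m a b z x) =
    (\<lambda>p. (if (\<forall>i\<in>{1..m}. 0 \<le> snd p i \<and> snd p i \<le> fst p) \<and>
             (\<forall>i\<in>{1..<m}. snd p i \<le> snd p (Suc i)) then 1 else 0)
          * (\<Prod>i=1..m. snd p i powr (a i - 1) * (1 - snd p i) powr (b i - 1)))"
    by (auto simp: ordered_beta_kernel_def ordered_region_def indicator_def fun_eq_iff)
  have comp [measurable]: "(\<lambda>p. snd p i) \<in> borel_measurable (borel \<Otimes>\<^sub>M lborel_on {1..m})"
    if "i \<in> {1..m}" for i
    using measurable_compose[OF measurable_snd measurable_component_singleton[OF that, of "\<lambda>_. lborel"], of borel]
    by (simp only: measurable_lborel1)
  have [measurable]: "Measurable.pred (borel \<Otimes>\<^sub>M lborel_on {1..m})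
       (\<lambda>p. \<forall>i\<in>{1..m}. 0 \<le> snd p i \<and> snd p i \<le> fst p)"
  proof (rule pred_intros_finite(3))
    fix i assume i: "i \<in> {1..m}"
    show "Measurable.pred (borel \<Otimes>\<^sub>M lborel_on {1..m}) (\<lambda>p. 0 \<le> snd p i \<and> snd p i \<le> fst p)"
      using sets.sets_Collect_conj[OF borel_measurable_le[OF comp[OF i] measurable_fst]
          borel_measurable_le[OF borel_measurable_const[of 0] comp[OF i]]]
      unfolding pred_def by (simp only: conj_commute)
  qed simp
  have [measurable]: "Measurable.pred (borel \<Otimes>\<^sub>M lborel_on {1..m})
       (\<lambda>p. \<forall>i\<in>{1..<m}. snd p i \<le> snd p (Suc i))"
  proof (rule pred_intros_finite(3))
    fix i assume "i \<in> {1..<m}"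
    then have "i \<in> {1..m}" "Suc i \<in> {1..m}" by auto
    then show "Measurable.pred (borel \<Otimes>\<^sub>M lborel_on {1..m}) (\<lambda>p. snd p i \<le> snd p (Suc i))"
      by measurable
  qed simp
  show ?thesis
    unfolding eq by measurable
qed

lemma measurable_ordered_beta_kernel [measurable]:
  "ordered_beta_kernel m a b z \<in> borel_measurable (lborel_on {1..m})"
  using measurable_compose[OF measurable_Pair1' measurable_ordered_beta_kernel_pair, of z] by simp

lemma measurable_gen_inc_beta [measurable]: "gen_inc_beta m a b \<in> borel_measurable borel"
proof -
  interpret product_sigma_finite "\<lambda>_::nat. lborel :: real measure" by standard
  \<comment> \<open>Sigma-finiteness of the product measure makes an integral depending on the
    parameter \<open>z\<close> measurable in \<open>z\<close>.\<close>
  interpret finite_product_sigma_finite "\<lambda>_::nat. lborel :: real measure" "{1..m}" by standard simp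
  show ?thesis
    unfolding gen_inc_beta_def[abs_def]
    by (rule borel_measurable_lebesgue_integral[OF measurable_ordered_beta_kernel_pair])
qed

text \<open>Forgetting the order bounds the kernel by a product of one-dimensional beta integrands,
  each of finite integral because the parameters are positive; \<open>z \<le> 1\<close> keeps every
  coordinate in the unit interval. Hence \<open>gen_inc_beta\<close> is a genuine integral and not
  the default value 0.\<close>

lemma nn_integral_ordered_beta_kernel:
  assumes "\<And>i. i \<in> {1..m} \<Longrightarrow> a i > 0" "\<And>i. i \<in> {1..m} \<Longrightarrow> b i > 0" "z \<le> 1"
  shows "(\<integral>\<^sup>+x. ennreal (ordered_beta_kernel m a b z x) \<partial>lborel_on {1..m})
           = ennreal (gen_inc_beta m a b z)"
    and "integrable (lborel_on {1..m}) (ordered_beta_kernel m a b z)"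
proof -
  interpret product_sigma_finite "\<lambda>_::nat. lborel :: real measure" by standard
  define f where "f i t = ennreal (indicator {0..1} t * (t powr (a i - 1) * (1 - t) powr (b i - 1)))"
    for i and t :: real
  have [measurable]: "f i \<in> borel_measurable borel" for i
    unfolding f_def[abs_def] by measurable
  have fin: "integral\<^sup>N lborel (f i) < \<infinity>" if "i \<in> {1..m}" for i
    using integrable_Beta[of "a i" "b i"] assms that
    unfolding set_integrable_def f_def[abs_def]
    by (auto simp: integrable_iff_bounded abs_mult)
  have "(\<integral>\<^sup>+x. ennreal (ordered_beta_kernel m a b z x) \<partial>lborel_on {1..m})
        \<le> (\<integral>\<^sup>+x. (\<Prod>i\<in>{1..m}. f i (x i)) \<partial>lborel_on {1..m})"
  proof (rule nn_integral_mono)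
    fix x :: "nat \<Rightarrow> real"
    show "ennreal (ordered_beta_kernel m a b z x) \<le> (\<Prod>i\<in>{1..m}. f i (x i))"
    proof (cases "x \<in> ordered_region m z")
      case True
      then have "\<And>i. i \<in> {1..m} \<Longrightarrow> x i \<in> {0..1}"
        using \<open>z \<le> 1\<close> by (force simp: ordered_region_def)
      then show ?thesis using True
        by (simp add: ordered_beta_kernel_def f_def prod_ennreal prod_nonneg)
    qed (simp add: ordered_beta_kernel_def)
  qed
  also have "\<dots> = (\<Prod>i\<in>{1..m}. integral\<^sup>N lborel (f i))"
    by (rule product_nn_integral_prod) auto
  also have "\<dots> < \<infinity>"
    using fin by (auto simp: less_top[symmetric] ennreal_prod_eq_top)
  finally show int: "integrable (lborel_on {1..m}) (ordered_beta_kernel m a b z)"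
    using measurable_ordered_beta_kernel[of m a b z]
    unfolding integrable_iff_bounded by (simp add: ordered_beta_kernel_nonneg)
  show "(\<integral>\<^sup>+x. ennreal (ordered_beta_kernel m a b z x) \<partial>lborel_on {1..m})
           = ennreal (gen_inc_beta m a b z)"
    unfolding gen_inc_beta_def
    by (rule nn_integral_eq_integral[OF int]) (simp add: ordered_beta_kernel_nonneg)
qed

section \<open>Reflection of coordinates\<close>

text \<open>The affine map has slope -1, so its Jacobian factor is 1.\<close>

lemma distr_lborel_one_minus: "distr lborel borel (\<lambda>t. 1 - t) = (lborel :: real measure)"
  using lborel_real_affine[of "-1" 1] by (simp add: density_1)

lemma measurable_reflect:
  assumes "k \<le> n"
  shows "(\<lambda>x. restrict (reflect n x) {1..n-k}) \<in>
      lborel_on {k+1..n} \<rightarrow>\<^sub>M lborel_on {1..n-k}"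
  unfolding reflect_def
proof (rule measurable_restrict)
  fix i assume "i \<in> {1..n-k}"
  then have "n + 1 - i \<in> {k+1..n}" by auto
  from measurable_lborel_on_component[OF this]
  have "(\<lambda>x. 1 - x (n + 1 - i)) \<in> borel_measurable (lborel_on {k+1..n})"
    by (intro borel_measurable_diff borel_measurable_const)
  then show "(\<lambda>x. 1 - x (n + 1 - i)) \<in> lborel_on {k+1..n} \<rightarrow>\<^sub>M lborel"
    unfolding measurable_lborel1 .
qed

text \<open>Boxes determine a product measure, and the preimage of a box under the reflection is a
  box with the reflected sides in reversed order.\<close>

lemma distr_PiM_reflect:
  assumes "k \<le> n"
  shows "distr (lborel_on {k+1..n}) (lborel_on {1..n-k})
           (\<lambda>x. restrict (reflect n x) {1..n-k}) = lborel_on {1..n-k}"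
proof -
  interpret product_sigma_finite "\<lambda>_::nat. lborel :: real measure" by standard
  note [measurable] = measurable_reflect[OF assms]
  show ?thesis
  proof (rule PiM_eqI)
    fix A :: "nat \<Rightarrow> real set" assume A: "\<And>i. i \<in> {1..n-k} \<Longrightarrow> A i \<in> sets lborel"
    \<comment> \<open>\<open>B j\<close> is the side of the preimage box in direction
      \<open>j\<close>; the index reversal below is its own inverse.\<close>
    define B where "B j = (\<lambda>t. 1 - t) -` A (n + 1 - j)" for j
    have bij: "bij_betw (\<lambda>j. n + 1 - j) {k+1..n} {1..n-k}"
      by (rule bij_betw_byWitness[where f'="\<lambda>j. n + 1 - j"]) auto
    have B: "B j \<in> sets borel" "emeasure lborel (B j) = emeasure lborel (A (n + 1 - j))"
      if "j \<in> {k+1..n}" for j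
    proof -
      have "n + 1 - j \<in> {1..n-k}" using that by auto
      then have Aj: "A (n + 1 - j) \<in> sets borel" using A by simp
      have [measurable]: "(\<lambda>t. 1 - t :: real) \<in> borel_measurable borel" by measurable
      show "B j \<in> sets borel"
        unfolding B_def by (rule measurable_sets_borel[OF _ Aj]) simp
      show "emeasure lborel (B j) = emeasure lborel (A (n + 1 - j))"
        by (subst (2) distr_lborel_one_minus[symmetric])
           (subst emeasure_distr, use Aj in \<open>auto simp: B_def\<close>)
    qed
    have pre: "(\<lambda>x. restrict (reflect n x) {1..n-k}) -` Pi\<^sub>E {1..n-k} A
                 \<inter> space (lborel_on {k+1..n}) = Pi\<^sub>E {k+1..n} B"
    proof -
      have "(\<forall>i\<in>{1..n-k}. 1 - x (n + 1 - i) \<in> A i) \<longleftrightarrow>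
            (\<forall>j\<in>{k+1..n}. 1 - x j \<in> A (n + 1 - j))" for x :: "nat \<Rightarrow> real"
        unfolding bij_betw_imp_surj_on[OF bij, symmetric] by auto
      then show ?thesis
        by (auto simp: PiE_iff space_PiM B_def reflect_def)
    qed
    have "emeasure (distr (lborel_on {k+1..n}) (lborel_on {1..n-k})
            (\<lambda>x. restrict (reflect n x) {1..n-k})) (Pi\<^sub>E {1..n-k} A)
          = emeasure (lborel_on {k+1..n}) (Pi\<^sub>E {k+1..n} B)"
      using A unfolding pre[symmetric]
      by (intro emeasure_distr measurable_reflect assms sets_PiM_I_finite) auto
    also have "\<dots> = (\<Prod>j\<in>{k+1..n}. emeasure lborel (B j))"
      by (rule emeasure_PiM) (use B in auto)
    also have "\<dots> = (\<Prod>j\<in>{k+1..n}. emeasure lborel (A (n + 1 - j)))"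
      using B by (intro prod.cong) auto
    also have "\<dots> = (\<Prod>i\<in>{1..n-k}. emeasure lborel (A i))"
      by (rule prod.reindex_bij_betw[OF bij])
    finally show "emeasure (distr (lborel_on {k+1..n}) (lborel_on {1..n-k})
            (\<lambda>x. restrict (reflect n x) {1..n-k})) (Pi\<^sub>E {1..n-k} A)
          = (\<Prod>i\<in>{1..n-k}. emeasure lborel (A i))" .
  qed auto
qed

text \<open>Indices and values are both reversed, so monotonicity is preserved. The bounds
  \<open>0\<close> and \<open>1 - z\<close> turn into \<open>1\<close> and \<open>z\<close>, and
  exchanging \<open>x i\<close> with \<open>1 - x i\<close> swaps the two parameter
  families.\<close>

lemma ordered_beta_kernel_reflect:
  assumes "k \<le> n"
  shows "ordered_beta_kernel (n - k) (rev_idx n b) (rev_idx n a) (1 - z) (reflect n x) =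
    indicator {x. (\<forall>i\<in>{k+1..n}. z \<le> x i \<and> x i \<le> 1) \<and> mono_on {k+1..n} x} x
      * (\<Prod>i=k+1..n. x i powr (a i - 1) * (1 - x i) powr (b i - 1))"
proof -
  have bij: "bij_betw (\<lambda>j. n + 1 - j) {k+1..n} {1..n-k}"
    by (rule bij_betw_byWitness[where f'="\<lambda>j. n + 1 - j"]) (use assms in auto)
  note surj = bij_betw_imp_surj_on[OF bij, symmetric]
  have "(\<forall>i\<in>{1..n-k}. 0 \<le> reflect n x i \<and> reflect n x i \<le> 1 - z) \<longleftrightarrow>
        (\<forall>j\<in>{k+1..n}. z \<le> x j \<and> x j \<le> 1)"
    unfolding surj by (auto simp: reflect_def)
  moreover have "mono_on {1..n-k} (reflect n x) \<longleftrightarrow> mono_on {k+1..n} x"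
  proof
    assume *: "mono_on {1..n-k} (reflect n x)"
    show "mono_on {k+1..n} x"
    proof (rule mono_onI)
      fix r s assume "r \<in> {k+1..n}" "s \<in> {k+1..n}" "r \<le> s"
      then show "x r \<le> x s"
        using mono_onD[OF *, of "n + 1 - s" "n + 1 - r"] by (auto simp: reflect_def)
    qed
  next
    assume *: "mono_on {k+1..n} x"
    show "mono_on {1..n-k} (reflect n x)"
    proof (rule mono_onI)
      fix r s assume "r \<in> {1..n-k}" "s \<in> {1..n-k}" "r \<le> s"
      then show "reflect n x r \<le> reflect n x s"
        using mono_onD[OF *, of "n + 1 - s" "n + 1 - r"] by (auto simp: reflect_def)
    qed
  qed
  ultimately have "reflect n x \<in> ordered_region (n - k) (1 - z) \<longleftrightarrow>
      x \<in> {x. (\<forall>i\<in>{k+1..n}. z \<le> x i \<and> x i \<le> 1) \<and> mono_on {k+1..n} x}"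
    by (simp add: ordered_region_iff_mono_on)
  moreover have "(\<Prod>i=1..n-k. reflect n x i powr (rev_idx n b i - 1) * (1 - reflect n x i) powr (rev_idx n a i - 1))
     = (\<Prod>i=k+1..n. x i powr (a i - 1) * (1 - x i) powr (b i - 1))"
    by (subst prod.reindex_bij_betw[OF bij, symmetric])
       (auto intro!: prod.cong simp: reflect_def rev_idx_def)
  ultimately show ?thesis
    by (simp add: ordered_beta_kernel_def indicator_def)
qed

text \<open>Change of variables by the measure-preserving reflection. The hypothesis
  \<open>0 \<le> z\<close> supplies the bound \<open>1 - z \<le> 1\<close> for the reflected
  chain.\<close>

lemma nn_integral_ordered_beta_kernel_reflect:
  assumes "k \<le> n" "\<And>i. i \<in> {1..n} \<Longrightarrow> a i > 0" "\<And>i. i \<in> {1..n} \<Longrightarrow> b i > 0" "0 \<le> z"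
  shows "(\<integral>\<^sup>+x. ennreal (ordered_beta_kernel (n - k) (rev_idx n b) (rev_idx n a) (1 - z) (reflect n x))
            \<partial>lborel_on {k+1..n})
         = ennreal (gen_inc_beta (n - k) (rev_idx n b) (rev_idx n a) (1 - z))"
proof -
  have "(\<integral>\<^sup>+x. ennreal (ordered_beta_kernel (n - k) (rev_idx n b) (rev_idx n a) (1 - z) (reflect n x))
            \<partial>lborel_on {k+1..n}) =
     (\<integral>\<^sup>+x. ennreal (ordered_beta_kernel (n - k) (rev_idx n b) (rev_idx n a) (1 - z)
           (restrict (reflect n x) {1..n-k})) \<partial>lborel_on {k+1..n})"
    by (intro nn_integral_cong arg_cong[where f=ennreal] ordered_beta_kernel_cong) simp
  also have "\<dots> = (\<integral>\<^sup>+y. ennreal (ordered_beta_kernel (n - k) (rev_idx n b) (rev_idx n a) (1 - z) y)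
        \<partial>lborel_on {1..n-k})"
    using nn_integral_distr[OF measurable_reflect[OF \<open>k \<le> n\<close>],
      of "\<lambda>y. ennreal (ordered_beta_kernel (n - k) (rev_idx n b) (rev_idx n a) (1 - z) y)"]
      measurable_compose[OF measurable_ordered_beta_kernel measurable_ennreal]
    by (simp only: distr_PiM_reflect[OF \<open>k \<le> n\<close>])
  also have "\<dots> = ennreal (gen_inc_beta (n - k) (rev_idx n b) (rev_idx n a) (1 - z))"
    unfolding rev_idx_def
    by (rule nn_integral_ordered_beta_kernel; (rule assms(2) assms(3))?) (use assms(1,4) in auto)
  finally show ?thesis .
qed

section \<open>Splitting the kernel\<close>

text \<open>Tonelli for two disjoint blocks of coordinates; the restrictions record that each factor
  reads only its own block.\<close>

lemma nn_integral_PiM_mult_disjoint: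
  fixes I J :: "nat set"
  assumes "I \<inter> J = {}" "finite I" "finite J"
    and [measurable]: "f \<in> borel_measurable (lborel_on I)"
      "g \<in> borel_measurable (lborel_on J)"
  shows "(\<integral>\<^sup>+x. f (restrict x I) * g (restrict x J) \<partial>lborel_on (I \<union> J)) =
    (\<integral>\<^sup>+x. f x \<partial>lborel_on I) * (\<integral>\<^sup>+x. g x \<partial>lborel_on J)"
proof -
  interpret product_sigma_finite "\<lambda>_::nat. lborel :: real measure" by standard
  have [measurable]: "(\<lambda>x. restrict x I) \<in> lborel_on (I \<union> J) \<rightarrow>\<^sub>M lborel_on I"
    "(\<lambda>x. restrict x J) \<in> lborel_on (I \<union> J) \<rightarrow>\<^sub>M lborel_on J"
    by (auto intro!: measurable_restrict_subset)
  have "(\<integral>\<^sup>+x. f (restrict x I) * g (restrict x J) \<partial>lborel_on (I \<union> J)) =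
    (\<integral>\<^sup>+x. \<integral>\<^sup>+y. f (restrict (merge I J (x, y)) I) * g (restrict (merge I J (x, y)) J)
        \<partial>lborel_on J \<partial>lborel_on I)"
    by (rule product_nn_integral_fold) (use assms(1-3) in auto)
  \<comment> \<open>Restricting a merged pair to a block returns the component, since points of the
    product spaces are extensional.\<close>
  also have "\<dots> = (\<integral>\<^sup>+x. \<integral>\<^sup>+y. f x * g y \<partial>lborel_on J \<partial>lborel_on I)"
    using assms(1) by (intro nn_integral_cong)
      (simp add: space_PiM PiE_def extensional_restrict)
  also have "\<dots> = (\<integral>\<^sup>+x. f x \<partial>lborel_on I) * (\<integral>\<^sup>+x. g x \<partial>lborel_on J)"
    by (simp add: nn_integral_cmult nn_integral_multc)
  finally show ?thesis .
qed

text \<open>The level separates the two blocks, so every inequality across them is implied and the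
  two chains can be glued. Both conditions are closed at \<open>z\<close>, like the two chains on
  the right, which makes the identity exact at every \<open>x\<close>.\<close>

lemma ordered_beta_kernel_split_at:
  assumes "k \<le> n" "z \<in> {0..1}"
  shows "ordered_beta_kernel n a b 1 x *
      indicator {x. (\<forall>i\<in>{1..k}. x i \<le> z) \<and> (\<forall>i\<in>{k+1..n}. z \<le> x i)} x =
    ordered_beta_kernel k a b z x *
      ordered_beta_kernel (n - k) (rev_idx n b) (rev_idx n a) (1 - z) (reflect n x)"
proof -
  have split: "{1..n} = {1..k} \<union> {k+1..n}" using assms by auto
  have prod: "(\<Prod>i=1..n. f i) = (\<Prod>i=1..k. f i) * (\<Prod>i=k+1..n. f i)" for f :: "nat \<Rightarrow> real"
    unfolding split by (rule prod.union_disjoint) auto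
  let ?S = "{x. (\<forall>i\<in>{1..k}. x i \<le> z) \<and> (\<forall>i\<in>{k+1..n}. z \<le> x i)}"
  let ?T = "{x. (\<forall>i\<in>{k+1..n}. z \<le> x i \<and> x i \<le> 1) \<and> mono_on {k+1..n} x}"
  have "x \<in> ordered_region n 1 \<and> (\<forall>i\<in>{1..k}. x i \<le> z) \<and> (\<forall>i\<in>{k+1..n}. z \<le> x i) \<longleftrightarrow>
     x \<in> ordered_region k z \<and> (\<forall>i\<in>{k+1..n}. z \<le> x i \<and> x i \<le> 1) \<and> mono_on {k+1..n} x"
    (is "?L \<longleftrightarrow> ?R")
  proof
    assume ?L then show ?R
      using assms by (auto simp: ordered_region_iff_mono_on intro: mono_on_subset)
  next
    assume R: ?R
    have "mono_on {1..n} x"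
    proof (rule mono_onI)
      fix r s assume rs: "r \<in> {1..n}" "s \<in> {1..n}" "r \<le> s"
      show "x r \<le> x s"
      proof (cases "s \<le> k \<or> k < r")
        case True
        then show ?thesis using R rs by (auto simp: ordered_region_iff_mono_on mono_on_def)
      next
        \<comment> \<open>Here \<open>r \<le> k < s\<close>: the indices lie in different blocks and
          \<open>z\<close> lies between the values.\<close>
        case False
        then have "x r \<le> z" "z \<le> x s"
          using R rs by (auto simp: ordered_region_iff_mono_on)
        then show ?thesis by simp
      qed
    qed
    moreover have "0 \<le> x i \<and> x i \<le> 1" if "i \<in> {1..n}" for i
    proof (cases "i \<le> k")
      case True
      then have "0 \<le> x i" "x i \<le> z"
        using R that by (auto simp: ordered_region_iff_mono_on)
      then show ?thesis using assms(2) by auto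
    next
      case False
      then have "z \<le> x i" "x i \<le> 1" using R that by auto
      then show ?thesis using assms(2) by auto
    qed
    ultimately have "x \<in> ordered_region n 1"
      by (simp add: ordered_region_iff_mono_on)
    moreover have "\<forall>i\<in>{1..k}. x i \<le> z"
      using R by (simp add: ordered_region_iff_mono_on)
    ultimately show ?L using R by blast
  qed
  then have iff: "(x \<in> ordered_region n 1 \<and> x \<in> ?S) = (x \<in> ordered_region k z \<and> x \<in> ?T)"
    by blast
  have and_ind: "indicator A x * indicator B x = (of_bool (x \<in> A \<and> x \<in> B) :: real)" for A B
    by (simp add: indicator_def)
  have ind: "indicator (ordered_region n 1) x * indicator ?S x
      = (indicator (ordered_region k z) x * indicator ?T x :: real)"
    unfolding and_ind iff ..
  have comm: "u * (p * q) * s = (v * p) * (t * q)" if "u * s = v * t" for u v s t p q :: real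
    using that by algebra
  show ?thesis
    unfolding ordered_beta_kernel_reflect[OF assms(1)] unfolding prod ordered_beta_kernel_def
    by (rule comm[OF ind])
qed

text \<open>This is the splitting at the level \<open>x k\<close> itself, with the factor of
  coordinate \<open>k\<close> taken out. The indicator of the unit interval covers
  \<open>k = 1\<close> and \<open>k = n\<close>, where an empty block would impose no bound on
  \<open>x k\<close>.\<close>

lemma ordered_beta_kernel_split_coordinate:
  assumes "k \<in> {1..n}"
  shows "ordered_beta_kernel n a b 1 x =
    indicator {0..1} (x k) * (x k powr (a k - 1) * (1 - x k) powr (b k - 1)) *
    (ordered_beta_kernel (k - 1) a b (x k) x *
      ordered_beta_kernel (n - k) (rev_idx n b) (rev_idx n a) (1 - x k) (reflect n x))"
proof (cases "x k \<in> {0..1}")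
  case True
  have "k - 1 \<le> n" using assms by auto
  have prod: "(\<Prod>i=1..k. f i) = f k * (\<Prod>i=1..k-1. f i)" for f :: "nat \<Rightarrow> real"
    using assms by (cases k) (auto simp: mult.commute)
  \<comment> \<open>The inequality between \<open>x (k - 1)\<close> and \<open>x k\<close> is
    already the upper bound of the shorter chain, so coordinate \<open>k\<close> adds only
    \<open>0 \<le> x k\<close>, which \<open>True\<close> provides.\<close>
  have "x \<in> ordered_region k (x k) \<longleftrightarrow> x \<in> ordered_region (k - 1) (x k)"
  proof
    assume R: "x \<in> ordered_region (k - 1) (x k)"
    have "x i \<le> x (Suc i)" if "i \<in> {1..<k}" for i
      using R that by (cases "i = k - 1") (auto simp: ordered_region_def)
    moreover have "0 \<le> x i \<and> x i \<le> x k" if "i \<in> {1..k}" for i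
      using R that True by (cases "i = k") (auto simp: ordered_region_def)
    ultimately show "x \<in> ordered_region k (x k)" by (auto simp: ordered_region_def)
  qed (auto simp: ordered_region_def)
  then have kernel: "ordered_beta_kernel k a b (x k) x =
    (x k powr (a k - 1) * (1 - x k) powr (b k - 1)) * ordered_beta_kernel (k - 1) a b (x k) x"
    unfolding ordered_beta_kernel_def prod by (simp add: indicator_def)
  have "x \<in> {y. (\<forall>i\<in>{1..k}. y i \<le> x k) \<and> (\<forall>i\<in>{k+1..n}. x k \<le> y i)}"
    if "x \<in> ordered_region n 1"
    using that assms by (auto simp: ordered_region_iff_mono_on mono_on_def)
  then have "ordered_beta_kernel n a b 1 x = ordered_beta_kernel n a b 1 x *
      indicator {y. (\<forall>i\<in>{1..k}. y i \<le> x k) \<and> (\<forall>i\<in>{k+1..n}. x k \<le> y i)} x"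
    by (cases "x \<in> ordered_region n 1") (auto simp: ordered_beta_kernel_def)
  also have "\<dots> = ordered_beta_kernel k a b (x k) x *
      ordered_beta_kernel (n - k) (rev_idx n b) (rev_idx n a) (1 - x k) (reflect n x)"
    using assms True by (intro ordered_beta_kernel_split_at) auto
  finally show ?thesis
    unfolding kernel using True by simp
next
  case False
  then have "x \<notin> ordered_region n 1" using assms by (auto simp: ordered_region_def)
  then show ?thesis using False by (simp add: ordered_beta_kernel_def)
qed

lemma measurable_ordered_beta_kernel_reflect:
  assumes "k \<le> n"
  shows "(\<lambda>x. ordered_beta_kernel (n - k) a b z (reflect n x))
    \<in> borel_measurable (lborel_on {k+1..n})"
proof -
  have "(\<lambda>x. ordered_beta_kernel (n - k) a b z (reflect n x)) =
     (\<lambda>x. ordered_beta_kernel (n - k) a b z (restrict (reflect n x) {1..n-k}))"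
    by (intro ext ordered_beta_kernel_cong) simp
  then show ?thesis
    using measurable_compose[OF measurable_reflect[OF assms] measurable_ordered_beta_kernel] by simp
qed

text \<open>Used with \<open>j = k\<close> for splitting at a fixed level and with
  \<open>j = k - 1\<close> when coordinate \<open>k\<close> is held fixed. In the latter case
  \<open>c\<close> carries the factors that depend on that coordinate.\<close>

lemma nn_integral_ordered_beta_kernel_mult_reflect:
  assumes "j \<le> k" "k \<le> n"
    and pos: "\<And>i. i \<in> {1..n} \<Longrightarrow> a i > 0" "\<And>i. i \<in> {1..n} \<Longrightarrow> b i > 0" and z: "z \<in> {0..1}"
  shows "(\<integral>\<^sup>+x. c * ennreal (ordered_beta_kernel j a b z x *
        ordered_beta_kernel (n - k) (rev_idx n b) (rev_idx n a) (1 - z) (reflect n x))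
      \<partial>lborel_on ({1..j} \<union> {k+1..n})) =
    c * ennreal (gen_inc_beta j a b z * gen_inc_beta (n - k) (rev_idx n b) (rev_idx n a) (1 - z))"
proof -
  let ?f = "\<lambda>x. c * ennreal (ordered_beta_kernel j a b z x)"
  let ?g = "\<lambda>x. ennreal (ordered_beta_kernel (n - k) (rev_idx n b) (rev_idx n a) (1 - z) (reflect n x))"
  have "(\<integral>\<^sup>+x. c * ennreal (ordered_beta_kernel j a b z x *
        ordered_beta_kernel (n - k) (rev_idx n b) (rev_idx n a) (1 - z) (reflect n x))
      \<partial>lborel_on ({1..j} \<union> {k+1..n})) =
    (\<integral>\<^sup>+x. ?f (restrict x {1..j}) * ?g (restrict x {k+1..n})
      \<partial>lborel_on ({1..j} \<union> {k+1..n}))"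
  proof (rule nn_integral_cong)
    fix x :: "nat \<Rightarrow> real"
    have "ordered_beta_kernel j a b z (restrict x {1..j}) = ordered_beta_kernel j a b z x"
      by (rule ordered_beta_kernel_cong) simp
    moreover have "ordered_beta_kernel (n - k) (rev_idx n b) (rev_idx n a) (1 - z) (reflect n (restrict x {k+1..n}))
      = ordered_beta_kernel (n - k) (rev_idx n b) (rev_idx n a) (1 - z) (reflect n x)"
    proof (rule ordered_beta_kernel_cong)
      fix i assume "i \<in> {1..n-k}"
      then have "n + 1 - i \<in> {k+1..n}" by auto
      then show "reflect n (restrict x {k+1..n}) i = reflect n x i"
        unfolding reflect_def by (simp only: restrict_apply' )
    qed
    ultimately show "c * ennreal (ordered_beta_kernel j a b z x *
        ordered_beta_kernel (n - k) (rev_idx n b) (rev_idx n a) (1 - z) (reflect n x)) =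
       ?f (restrict x {1..j}) * ?g (restrict x {k+1..n})"
      by (simp add: ennreal_mult ordered_beta_kernel_nonneg mult.assoc)
  qed
  also have "\<dots> = (\<integral>\<^sup>+x. ?f x \<partial>lborel_on {1..j}) * (\<integral>\<^sup>+x. ?g x \<partial>lborel_on {k+1..n})"
    using assms(1,2) measurable_ordered_beta_kernel_reflect[OF \<open>k \<le> n\<close>]
    by (intro nn_integral_PiM_mult_disjoint borel_measurable_times_ennreal borel_measurable_const
        measurable_compose[OF _ measurable_ennreal] measurable_ordered_beta_kernel) auto
  also have "(\<integral>\<^sup>+x. ?f x \<partial>lborel_on {1..j}) = c * ennreal (gen_inc_beta j a b z)"
  proof -
    have "(\<integral>\<^sup>+x. ennreal (ordered_beta_kernel j a b z x) \<partial>lborel_on {1..j}) = ennreal (gen_inc_beta j a b z)"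
      by (rule nn_integral_ordered_beta_kernel) (use assms in auto)
    then show ?thesis
      using measurable_compose[OF measurable_ordered_beta_kernel measurable_ennreal]
      by (simp only: nn_integral_cmult)
  qed
  also have "(\<integral>\<^sup>+x. ?g x \<partial>lborel_on {k+1..n}) =
      ennreal (gen_inc_beta (n - k) (rev_idx n b) (rev_idx n a) (1 - z))"
    by (rule nn_integral_ordered_beta_kernel_reflect) (use assms in auto)
  finally show ?thesis
    by (simp add: ennreal_mult gen_inc_beta_nonneg mult.assoc)
qed

text \<open>Since \<open>0 powr c = 0\<close>, this also holds at \<open>t = 0\<close>, so moment
  factors shift the kernel parameters at every point.\<close>

lemma powr_diff_one_mult_powr: "t powr (c - 1) * t powr d = t powr (c + d - 1)" for t c d :: real
  by (simp add: powr_add[symmetric] algebra_simps)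

section \<open>Random vectors with ordered beta distribution\<close>

locale ordered_beta_vector = prob_space M for M :: "'s measure" +
  fixes n :: nat and a b :: "nat \<Rightarrow> real" and X :: "nat \<Rightarrow> 's \<Rightarrow> real"
  assumes a_pos: "\<And>i. i \<in> {1..n} \<Longrightarrow> a i > 0" and b_pos: "\<And>i. i \<in> {1..n} \<Longrightarrow> b i > 0"
    and ordered_beta: "has_ordered_beta M n a b X"
begin

abbreviation C :: real where "C \<equiv> gen_beta n a b"

abbreviation V :: "'s \<Rightarrow> nat \<Rightarrow> real" where "V \<omega> \<equiv> \<lambda>i\<in>{1..n}. X i \<omega>"

text \<open>By reflection, for \<open>0 \<le> z\<close> this is the integral over the chains of the
  coordinates \<open>k + 1\<close> to \<open>n\<close> lying between \<open>z\<close> and 1.\<close>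

abbreviation tail_beta :: "nat \<Rightarrow> real \<Rightarrow> real" where
  "tail_beta k z \<equiv> gen_inc_beta (n - k) (rev_idx n b) (rev_idx n a) (1 - z)"

lemma distributed_V:
  "distributed M (lborel_on {1..n}) V (\<lambda>x. ennreal (inverse C * ordered_beta_kernel n a b 1 x))"
  using ordered_beta unfolding has_ordered_beta_def .

lemma distr_V:
  "distr M (lborel_on {1..n}) V =
     density (lborel_on {1..n}) (\<lambda>x. ennreal (inverse C * ordered_beta_kernel n a b 1 x))"
  using distributed_V unfolding distributed_def by blast

lemma measurable_V [measurable]: "V \<in> M \<rightarrow>\<^sub>M lborel_on {1..n}"
  using distributed_V unfolding distributed_def by blast

lemma measurable_X:
  assumes "k \<in> {1..n}"
  shows "X k \<in> borel_measurable M"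
proof -
  have "(\<lambda>\<omega>. V \<omega> k) \<in> M \<rightarrow>\<^sub>M lborel"
    by (rule measurable_compose[OF measurable_V measurable_component_singleton[OF assms]])
  then show ?thesis using assms by simp
qed

section \<open>Integration against the joint density and almost sure ordering\<close>

lemma nn_integral_V:
  assumes "g \<in> borel_measurable (lborel_on {1..n})"
  shows "(\<integral>\<^sup>+\<omega>. g (V \<omega>) \<partial>M) =
    ennreal (inverse C) * (\<integral>\<^sup>+x. ennreal (ordered_beta_kernel n a b 1 x) * g x \<partial>lborel_on {1..n})"
proof -
  have "(\<integral>\<^sup>+\<omega>. g (V \<omega>) \<partial>M) =
     (\<integral>\<^sup>+x. ennreal (inverse C * ordered_beta_kernel n a b 1 x) * g x \<partial>lborel_on {1..n})"
    by (rule distributed_nn_integral[OF distributed_V assms, symmetric])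
  also have "\<dots> = (\<integral>\<^sup>+x. ennreal (inverse C) * (ennreal (ordered_beta_kernel n a b 1 x) * g x)
      \<partial>lborel_on {1..n})"
  proof -
    have "ennreal (inverse C * p) = ennreal (inverse C) * ennreal p" for p
      by (rule ennreal_mult') (simp add: gen_beta_def gen_inc_beta_nonneg)
    then show ?thesis by (simp only: mult.assoc)
  qed
  also have "\<dots> = ennreal (inverse C) *
      (\<integral>\<^sup>+x. ennreal (ordered_beta_kernel n a b 1 x) * g x \<partial>lborel_on {1..n})"
    by (intro nn_integral_cmult borel_measurable_times_ennreal assms
        measurable_compose[OF measurable_ordered_beta_kernel measurable_ennreal])
  finally show ?thesis .
qed

text \<open>If \<open>C\<close> were 0, then \<open>inverse C\<close> would be 0 as well, and the
  law of the vector would have total mass 0 instead of 1.\<close>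

lemma C_pos: "C > 0"
proof -
  have "C \<noteq> 0"
  proof
    assume "C = 0"
    then have "(\<integral>\<^sup>+\<omega>. 1 \<partial>M) = 0"
      using nn_integral_V[of "\<lambda>_. 1"] by simp
    then show False by (simp add: emeasure_space_1)
  qed
  moreover have "C \<ge> 0"
    by (simp add: gen_beta_def gen_inc_beta_nonneg)
  ultimately show ?thesis by simp
qed

lemma AE_V_ordered: "AE \<omega> in M. V \<omega> \<in> ordered_region n 1"
proof -
  have "AE x in density (lborel_on {1..n}) (\<lambda>x. ennreal (inverse C * ordered_beta_kernel n a b 1 x)).
      x \<in> ordered_region n 1"
    using distributed_V unfolding distributed_def
    by (subst AE_density) (auto simp: ordered_beta_kernel_def indicator_def split: if_splits)
  then have "AE x in distr M (lborel_on {1..n}) V. x \<in> ordered_region n 1"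
    unfolding distr_V .
  then show ?thesis
    by (rule AE_distrD[OF measurable_V])
qed

lemma AE_mono_on_X: "AE \<omega> in M. mono_on {1..n} (\<lambda>i. X i \<omega>)"
  using AE_V_ordered
  by eventually_elim (auto simp: ordered_region_iff_mono_on mono_on_def)

section \<open>Density of a single coordinate\<close>

lemma distributed_coordinate:
  assumes "k \<in> {1..n}"
  shows "distributed M lborel (X k)
    (\<lambda>x. ennreal (indicator {0<..<1} x * (inverse C * x powr (a k - 1) * (1 - x) powr (b k - 1)
       * gen_inc_beta (k - 1) a b x * tail_beta k x)))" (is "distributed _ _ _ ?f")
proof -
  interpret product_sigma_finite "\<lambda>_::nat. lborel :: real measure" by standard
  let ?w = "\<lambda>x. indicator {0..1} x * (x powr (a k - 1) * (1 - x) powr (b k - 1)) :: real"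
  let ?J = "{1..k-1} \<union> {k+1..n}"
  note [measurable] = measurable_X[OF assms]
  have k: "insert k ?J = {1..n}" "k \<notin> ?J" "finite ?J" "k - 1 \<le> k" "k \<le> n"
    using assms by auto
  have f: "?f \<in> borel_measurable lborel"
    by measurable
  have "distr M lborel (X k) = density lborel ?f"
  proof (rule measure_eqI)
    fix A :: "real set" assume "A \<in> sets (distr M lborel (X k))"
    then have [measurable]: "A \<in> sets borel" by simp
    let ?F = "\<lambda>x. ennreal (ordered_beta_kernel n a b 1 x) * indicator A (x k)"
    have ind: "(\<lambda>x. indicator A (x k) :: ennreal) \<in> borel_measurable (lborel_on {1..n})"
      using measurable_component_singleton[OF assms, where M = "\<lambda>_. lborel :: real measure"]
      by (intro measurable_compose[where f="\<lambda>x. x k" and g="indicator A"]) auto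
    then have F: "?F \<in> borel_measurable (lborel_on {1..n})"
      by (intro borel_measurable_times_ennreal
          measurable_compose[OF measurable_ordered_beta_kernel measurable_ennreal])
    \<comment> \<open>For a fixed value \<open>y\<close> of coordinate \<open>k\<close>, the
      remaining coordinates form two independent blocks, below and above \<open>y\<close>.\<close>
    have inner: "(\<integral>\<^sup>+x. ?F (x(k := y)) \<partial>lborel_on ?J) =
        ennreal (?w y) * indicator A y * ennreal (gen_inc_beta (k - 1) a b y * tail_beta k y)" for y
    proof -
      have "?F (x(k := y)) = (ennreal (?w y) * indicator A y) *
         ennreal (ordered_beta_kernel (k - 1) a b y x *
           ordered_beta_kernel (n - k) (rev_idx n b) (rev_idx n a) (1 - y) (reflect n x))" for x
      proof -
        have "ordered_beta_kernel (k - 1) a b y (x(k := y)) = ordered_beta_kernel (k - 1) a b y x"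
          by (rule ordered_beta_kernel_cong) auto
        moreover have "ordered_beta_kernel (n - k) (rev_idx n b) (rev_idx n a) (1 - y) (reflect n (x(k := y)))
           = ordered_beta_kernel (n - k) (rev_idx n b) (rev_idx n a) (1 - y) (reflect n x)"
          using k by (intro ordered_beta_kernel_cong) (auto simp: reflect_def)
        ultimately have "ordered_beta_kernel n a b 1 (x(k := y)) = ?w y *
           (ordered_beta_kernel (k - 1) a b y x *
           ordered_beta_kernel (n - k) (rev_idx n b) (rev_idx n a) (1 - y) (reflect n x))"
          using ordered_beta_kernel_split_coordinate[OF assms, of a b "x(k := y)"] by simp
        moreover have "ennreal (p * q) * r = ennreal p * r * ennreal q" if "p \<ge> 0" "q \<ge> 0" for p q r
          using that by (simp add: ennreal_mult ac_simps)
        ultimately show ?thesis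
          by (simp add: ordered_beta_kernel_nonneg)
      qed
      then have eq: "(\<integral>\<^sup>+x. ?F (x(k := y)) \<partial>lborel_on ?J) =
         (\<integral>\<^sup>+x. (ennreal (?w y) * indicator A y) * ennreal (ordered_beta_kernel (k - 1) a b y x *
           ordered_beta_kernel (n - k) (rev_idx n b) (rev_idx n a) (1 - y) (reflect n x)) \<partial>lborel_on ?J)"
        by (simp only:)
      show ?thesis
      proof (cases "y \<in> {0..1}")
        case True
        show ?thesis
          unfolding eq using k True a_pos b_pos
          by (intro nn_integral_ordered_beta_kernel_mult_reflect) auto
      next
        case False
        then show ?thesis unfolding eq by simp
      qed
    qed
    have "emeasure (distr M lborel (X k)) A = (\<integral>\<^sup>+x. indicator A x \<partial>distr M lborel (X k))"
      by simp
    also have "\<dots> = (\<integral>\<^sup>+\<omega>. indicator A (X k \<omega>) \<partial>M)"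
      by (rule nn_integral_distr) auto
    also have "\<dots> = (\<integral>\<^sup>+\<omega>. indicator A (V \<omega> k) \<partial>M)"
      using assms by simp
    also have "\<dots> = ennreal (inverse C) * (\<integral>\<^sup>+x. ?F x \<partial>lborel_on {1..n})"
      by (rule nn_integral_V[OF ind])
    \<comment> \<open>Coordinate \<open>k\<close> is made the outer variable of the iterated
      integral.\<close>
    also have "(\<integral>\<^sup>+x. ?F x \<partial>lborel_on {1..n}) = (\<integral>\<^sup>+y. \<integral>\<^sup>+x. ?F (x(k := y)) \<partial>lborel_on ?J \<partial>lborel)"
      using product_nn_integral_insert_rev[OF k(3,2), unfolded k(1), OF F] .
    also have "\<dots> = (\<integral>\<^sup>+y. ennreal (?w y) * indicator A y *
         ennreal (gen_inc_beta (k - 1) a b y * tail_beta k y) \<partial>lborel)"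
      by (simp only: inner)
    also have "ennreal (inverse C) * \<dots> = (\<integral>\<^sup>+y. ennreal (inverse C) * (ennreal (?w y) * indicator A y *
         ennreal (gen_inc_beta (k - 1) a b y * tail_beta k y)) \<partial>lborel)"
      by (rule nn_integral_cmult[symmetric]) measurable
    also have "\<dots> = (\<integral>\<^sup>+y. ?f y * indicator A y \<partial>lborel)"
    proof (rule nn_integral_cong)
      fix y :: real
      \<comment> \<open>At the end points one of the powers is \<open>0 powr\<close> something,
        hence 0; the closed and the open indicator therefore give the same function.\<close>
      have "inverse C * (?w y * (gen_inc_beta (k - 1) a b y * tail_beta k y)) =
        indicator {0<..<1} y * (inverse C * y powr (a k - 1) * (1 - y) powr (b k - 1)
         * gen_inc_beta (k - 1) a b y * tail_beta k y)"
        by (cases "y = 0 \<or> y = 1") (auto simp: indicator_def)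
      moreover have "ennreal (inverse C) * (ennreal (?w y) * indicator A y *
         ennreal (gen_inc_beta (k - 1) a b y * tail_beta k y)) =
        ennreal (inverse C * (?w y * (gen_inc_beta (k - 1) a b y * tail_beta k y))) * indicator A y"
      proof -
        have "ennreal p * (ennreal q * s * ennreal r) = ennreal (p * (q * r)) * s"
          if "p \<ge> 0" "q \<ge> 0" "r \<ge> 0" for p q r s
          using that by (simp add: ennreal_mult ac_simps)
        then show ?thesis
          using C_pos gen_inc_beta_nonneg by simp
      qed
      ultimately show "ennreal (inverse C) * (ennreal (?w y) * indicator A y *
         ennreal (gen_inc_beta (k - 1) a b y * tail_beta k y)) = ?f y * indicator A y"
        by (simp only:)
    qed
    also have "\<dots> = emeasure (density lborel ?f) A"
      using f by (simp add: emeasure_density)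
    finally show "emeasure (distr M lborel (X k)) A = emeasure (density lborel ?f) A" .
  qed simp
  then show ?thesis
    unfolding distributed_def using f by simp
qed

text \<open>A law with a Lebesgue density has no atoms. This permits exchanging strict and weak
  inequalities at a level.\<close>

lemma AE_X_neq:
  assumes "k \<in> {1..n}"
  shows "AE \<omega> in M. X k \<omega> \<noteq> z"
proof -
  obtain f where f: "f \<in> borel_measurable lborel" "distr M lborel (X k) = density lborel f"
    using distributed_coordinate[OF assms] unfolding distributed_def by blast
  from AE_lborel_singleton[of z] have "AE x in distr M lborel (X k). x \<noteq> z"
    unfolding f(2) AE_density[OF f(1)] by (rule eventually_mono) simp
  then show ?thesis
    by (rule AE_distrD[rotated]) (use measurable_X[OF assms] in simp)
qed

section \<open>Level events and distribution functions\<close>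

text \<open>The upper block is strict so that events with different \<open>j\<close> are disjoint;
  the closed splitting of the kernel differs from this only by ties with \<open>z\<close>.\<close>

definition level_event :: "nat \<Rightarrow> real \<Rightarrow> 's set" where
  "level_event j z = {\<omega> \<in> space M. (\<forall>i\<in>{1..j}. X i \<omega> \<le> z) \<and> (\<forall>i\<in>{j+1..n}. z < X i \<omega>)}"

lemma sets_level_event:
  assumes "j \<le> n"
  shows "level_event j z \<in> sets M"
proof -
  have "{\<omega> \<in> space M. X i \<omega> \<le> z} \<in> sets M" "{\<omega> \<in> space M. z < X i \<omega>} \<in> sets M" if "i \<in> {1..n}" for i
    using measurable_X[OF that] by measurable
  then show ?thesis
    unfolding level_event_def using assms
    by (intro sets.sets_Collect_conj sets.sets_Collect_finite_All) auto
qed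

lemma prob_level_event:
  assumes "j \<le> n" "z \<in> {0..1}"
  shows "prob (level_event j z) = inverse C * gen_inc_beta j a b z * tail_beta j z"
proof -
  let ?S = "{x. (\<forall>i\<in>{1..j}. x i \<le> z) \<and> (\<forall>i\<in>{j+1..n}. z \<le> x i)}"
  have split: "{1..n} = {1..j} \<union> {j+1..n}" using assms by auto
  have S: "{x \<in> space (lborel_on {1..n}). x \<in> ?S} \<in> sets (lborel_on {1..n})"
    unfolding mem_Collect_eq using assms
    by (intro sets.sets_Collect_conj sets.sets_Collect_finite_All borel_measurable_le
        borel_measurable_const measurable_lborel_on_component) auto
  \<comment> \<open>\<open>?S\<close> contains functions that are not extensional, so measurability
    is shown for its trace on the product space and then transferred.\<close>
  have ind: "(\<lambda>x. indicator ?S x :: ennreal) \<in> borel_measurable (lborel_on {1..n})"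
    using borel_measurable_indicator[OF S]
    by (rule measurable_cong[THEN iffD1, rotated]) (auto simp: indicator_def)
  have "AE \<omega> in M. \<forall>i\<in>{1..n}. X i \<omega> \<noteq> z"
    using AE_X_neq by (intro eventually_ball_finite) auto
  then have "AE \<omega> in M. indicator (level_event j z) \<omega> = (indicator ?S (V \<omega>) :: ennreal)"
    using AE_space
  proof eventually_elim
    case (elim \<omega>)
    have "V \<omega> \<in> ?S \<longleftrightarrow> \<omega> \<in> level_event j z"
      using elim assms by (force simp: level_event_def less_le)
    then show ?case by (simp add: indicator_def)
  qed
  then have "(\<integral>\<^sup>+\<omega>. indicator (level_event j z) \<omega> \<partial>M) = (\<integral>\<^sup>+\<omega>. indicator ?S (V \<omega>) \<partial>M)"
    by (rule nn_integral_cong_AE)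
  then have "emeasure M (level_event j z) = (\<integral>\<^sup>+\<omega>. indicator ?S (V \<omega>) \<partial>M)"
    using nn_integral_indicator[OF sets_level_event[OF assms(1)]] by simp
  also have "\<dots> = ennreal (inverse C) *
     (\<integral>\<^sup>+x. ennreal (ordered_beta_kernel n a b 1 x) * indicator ?S x \<partial>lborel_on {1..n})"
    by (rule nn_integral_V[OF ind])
  also have "(\<integral>\<^sup>+x. ennreal (ordered_beta_kernel n a b 1 x) * indicator ?S x \<partial>lborel_on {1..n}) =
     (\<integral>\<^sup>+x. 1 * ennreal (ordered_beta_kernel j a b z x *
      ordered_beta_kernel (n - j) (rev_idx n b) (rev_idx n a) (1 - z) (reflect n x))
      \<partial>lborel_on ({1..j} \<union> {j+1..n}))"
    unfolding ordered_beta_kernel_split_at[OF assms, symmetric] split[symmetric]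
    by (intro nn_integral_cong) (simp add: indicator_def)
  also have "\<dots> = 1 * ennreal (gen_inc_beta j a b z * tail_beta j z)"
    using assms a_pos b_pos by (intro nn_integral_ordered_beta_kernel_mult_reflect) auto
  also have "ennreal (inverse C) * \<dots> = ennreal (inverse C * gen_inc_beta j a b z * tail_beta j z)"
    using C_pos by (simp add: ennreal_mult[symmetric] gen_inc_beta_nonneg mult.assoc)
  finally show ?thesis
    using C_pos by (simp add: measure_def gen_inc_beta_nonneg)
qed

text \<open>Inside one event, the index alone decides on which side of \<open>z\<close> a coordinate
  lies, so conditions on coordinates become conditions on \<open>j\<close>.\<close>

lemma level_event_iff:
  assumes "\<omega> \<in> level_event j z" "k \<in> {1..n}"
  shows "X k \<omega> \<le> z \<longleftrightarrow> k \<le> j"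
  using assms unfolding level_event_def by (cases "k \<le> j") (auto simp: not_le)

text \<open>Coordinate \<open>max i j\<close> is at most \<open>z\<close> on one of the two events
  and above \<open>z\<close> on the other.\<close>

lemma disjoint_level_event: "disjoint_family_on (\<lambda>j. level_event j z) {..n}"
  unfolding disjoint_family_on_def
proof (intro ballI impI)
  fix i j assume ij: "i \<in> {..n}" "j \<in> {..n}" "i \<noteq> j"
  then have m: "max i j \<in> {1..n}" by auto
  have "max i j \<le> i \<longleftrightarrow> max i j \<le> j" if "\<omega> \<in> level_event i z" "\<omega> \<in> level_event j z" for \<omega>
    using that[THEN level_event_iff[OF _ m]] by blast
  then show "level_event i z \<inter> level_event j z = {}"
    using ij(3) by fastforce
qed

lemma AE_level_event: "AE \<omega> in M. \<exists>j\<le>n. \<omega> \<in> level_event j z"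
  using AE_mono_on_X AE_space
proof eventually_elim
  case (elim \<omega>)
  \<comment> \<open>The witness is the last index whose coordinate is at most \<open>z\<close>; the
    inserted 0 is the answer when there is none. Monotonicity then handles all earlier
    indices.\<close>
  define j where "j = Max (insert 0 {i\<in>{1..n}. X i \<omega> \<le> z})"
  have fin: "finite (insert 0 {i\<in>{1..n}. X i \<omega> \<le> z})" by simp
  have j: "j = 0 \<or> (j \<in> {1..n} \<and> X j \<omega> \<le> z)"
    using Max_in[OF fin] unfolding j_def by auto
  have le: "i \<le> j" if "i \<in> {1..n}" "X i \<omega> \<le> z" for i
    unfolding j_def using fin that by (intro Max_ge) auto
  have "X i \<omega> \<le> z" if "i \<in> {1..j}" for i
    using j that mono_onD[OF elim(1), of i j] by force
  moreover have "z < X i \<omega>" if "i \<in> {j+1..n}" for i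
    using le[of i] that by force
  ultimately show ?case
    using j elim(2) by (intro exI[of _ j]) (auto simp: level_event_def)
qed

text \<open>The level events partition the space almost surely. An event decided on each of them by
  membership of \<open>j\<close> in \<open>K\<close> is thus their union over \<open>K\<close>, up
  to a null set.\<close>

lemma prob_level_events:
  assumes "K \<subseteq> {..n}" "z \<in> {0..1}" "S \<in> sets M"
    and "\<And>\<omega> j. \<omega> \<in> level_event j z \<Longrightarrow> j \<le> n \<Longrightarrow> \<omega> \<in> S \<longleftrightarrow> j \<in> K"
  shows "prob S = (\<Sum>j\<in>K. inverse C * gen_inc_beta j a b z * tail_beta j z)"
proof -
  have fin: "finite K" using assms(1) finite_subset by blast
  have ev: "level_event j z \<in> sets M" if "j \<in> K" for j
    using sets_level_event assms(1) that by auto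
  have "AE \<omega> in M. \<omega> \<in> S \<longleftrightarrow> \<omega> \<in> (\<Union>j\<in>K. level_event j z)"
    using AE_level_event[of z]
  proof eventually_elim
    case (elim \<omega>)
    then obtain j where j: "j \<le> n" "\<omega> \<in> level_event j z" by auto
    moreover have "i = j" if "i \<in> K" "\<omega> \<in> level_event i z" for i
      using disjoint_level_event[of z] that j assms(1) unfolding disjoint_family_on_def by blast
    ultimately show ?case using assms(4)[of \<omega> j] by blast
  qed
  then have "prob S = prob (\<Union>j\<in>K. level_event j z)"
    using assms(3) ev fin by (intro measure_eq_AE) auto
  also have "\<dots> = (\<Sum>j\<in>K. prob (level_event j z))"
    using ev fin disjoint_family_on_mono[OF assms(1) disjoint_level_event]
    by (intro finite_measure_finite_Union) auto
  also have "\<dots> = (\<Sum>j\<in>K. inverse C * gen_inc_beta j a b z * tail_beta j z)"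
    using assms by (intro sum.cong prob_level_event) auto
  finally show ?thesis .
qed

lemma prob_X_le:
  assumes "k \<in> {1..n}" "z \<in> {0..1}"
  shows "\<P>(\<omega> in M. X k \<omega> \<le> z) = (\<Sum>j=k..n. inverse C * gen_inc_beta j a b z * tail_beta j z)"
proof (rule prob_level_events)
  show "{\<omega> \<in> space M. X k \<omega> \<le> z} \<in> sets M"
    using measurable_X[OF assms(1)] by measurable
  show "\<omega> \<in> {\<omega> \<in> space M. X k \<omega> \<le> z} \<longleftrightarrow> j \<in> {k..n}" if "\<omega> \<in> level_event j z" "j \<le> n" for \<omega> j
    using level_event_iff[OF that(1) assms(1)] that by (auto simp: level_event_def)
qed (use assms in auto)

lemma prob_X_gt:
  assumes "k \<in> {1..n}" "z \<in> {0..1}"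
  shows "\<P>(\<omega> in M. z < X k \<omega>) = (\<Sum>j=0..k-1. inverse C * gen_inc_beta j a b z * tail_beta j z)"
proof (rule prob_level_events)
  show "{\<omega> \<in> space M. z < X k \<omega>} \<in> sets M"
    using measurable_X[OF assms(1)] by measurable
  show "\<omega> \<in> {\<omega> \<in> space M. z < X k \<omega>} \<longleftrightarrow> j \<in> {0..k-1}" if "\<omega> \<in> level_event j z" "j \<le> n" for \<omega> j
    using level_event_iff[OF that(1) assms(1)] that assms by (auto simp: level_event_def)
qed (use assms in auto)

lemma prob_X_between:
  assumes "k \<in> {1..n-1}" "z \<in> {0..1}"
  shows "\<P>(\<omega> in M. X k \<omega> \<le> z \<and> z < X (k + 1) \<omega>) = inverse C * gen_inc_beta k a b z * tail_beta k z"
proof -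
  have k: "k \<in> {1..n}" "k + 1 \<in> {1..n}" using assms by auto
  \<comment> \<open>The conditions \<open>k \<le> j\<close> and not \<open>k + 1 \<le> j\<close>
    leave only \<open>j = k\<close>.\<close>
  have "\<P>(\<omega> in M. X k \<omega> \<le> z \<and> z < X (k + 1) \<omega>)
     = (\<Sum>j\<in>{k}. inverse C * gen_inc_beta j a b z * tail_beta j z)"
  proof (rule prob_level_events)
    show "{\<omega> \<in> space M. X k \<omega> \<le> z \<and> z < X (k + 1) \<omega>} \<in> sets M"
      using measurable_X[OF k(1)] measurable_X[OF k(2)] by measurable
    show "\<omega> \<in> {\<omega> \<in> space M. X k \<omega> \<le> z \<and> z < X (k + 1) \<omega>} \<longleftrightarrow> j \<in> {k}"
      if "\<omega> \<in> level_event j z" "j \<le> n" for \<omega> j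
      using level_event_iff[OF that(1) k(1)] level_event_iff[OF that(1) k(2)] that
      by (auto simp: level_event_def)
  qed (use assms in auto)
  then show ?thesis by simp
qed

section \<open>Law of the reflected vector\<close>

lemma reflect_ordered_beta:
  "has_ordered_beta M n (rev_idx n b) (rev_idx n a) (rev_idx n (\<lambda>i \<omega>. 1 - X i \<omega>))"
proof -
  let ?N = "lborel_on {1..n}"
  let ?R = "\<lambda>x. restrict (reflect n x) {1..n}"
  let ?f = "\<lambda>x. ennreal (inverse C * ordered_beta_kernel n a b 1 x)"
  let ?g = "\<lambda>x. ennreal (inverse (gen_beta n (rev_idx n b) (rev_idx n a))
              * ordered_beta_kernel n (rev_idx n b) (rev_idx n a) 1 x)"
  have R: "?R \<in> ?N \<rightarrow>\<^sub>M ?N"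
    using measurable_reflect[of 0 n] by simp
  have distr_R: "distr ?N ?N ?R = ?N"
    using distr_PiM_reflect[of 0 n] by simp
  have kernel: "ordered_beta_kernel n (rev_idx n b) (rev_idx n a) 1 (reflect n x)
     = ordered_beta_kernel n a b 1 x" for x
  proof -
    \<comment> \<open>The bounds are written with \<open>0+1\<close> and the lower level 0 to match
      the reflection identity at \<open>k = 0\<close>, \<open>z = 0\<close>, where the tail is the
      whole chain.\<close>
    have region: "ordered_region n 1 =
        {x. (\<forall>i\<in>{0+1..n}. 0 \<le> x i \<and> x i \<le> 1) \<and> mono_on {0+1..n} x}"
      by (auto simp: ordered_region_iff_mono_on)
    show ?thesis
      using ordered_beta_kernel_reflect[of 0 n b a 0 x]
      unfolding ordered_beta_kernel_def[of n a b] region by simp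
  qed
  have "ennreal (gen_beta n (rev_idx n b) (rev_idx n a))
     = (\<integral>\<^sup>+x. ennreal (ordered_beta_kernel n a b 1 x) \<partial>?N)"
    using nn_integral_ordered_beta_kernel_reflect[of 0 n a b 0] a_pos b_pos
    by (simp add: kernel gen_beta_def)
  also have "\<dots> = ennreal C"
    unfolding gen_beta_def using a_pos b_pos by (intro nn_integral_ordered_beta_kernel) auto
  finally have const: "gen_beta n (rev_idx n b) (rev_idx n a) = C"
    by (simp add: gen_beta_def gen_inc_beta_nonneg)
  have g: "?g \<in> borel_measurable ?N"
    by (intro measurable_compose[OF _ measurable_ennreal] borel_measurable_times
        borel_measurable_const measurable_ordered_beta_kernel)
  have gR: "?g (?R x) = ?f x" for x
  proof -
    have "ordered_beta_kernel n (rev_idx n b) (rev_idx n a) 1 (?R x)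
       = ordered_beta_kernel n (rev_idx n b) (rev_idx n a) 1 (reflect n x)"
      by (rule ordered_beta_kernel_cong) simp
    then show ?thesis by (simp only: kernel const)
  qed
  have RV: "(\<lambda>\<omega>. \<lambda>i\<in>{1..n}. rev_idx n (\<lambda>i \<omega>. 1 - X i \<omega>) i \<omega>) = ?R \<circ> V"
    by (auto simp: fun_eq_iff reflect_def rev_idx_def)
  have "distr M ?N (?R \<circ> V) = distr (distr M ?N V) ?N ?R"
    by (rule distr_distr[symmetric, OF R measurable_V])
  also have "\<dots> = distr (density ?N ?f) ?N ?R"
    unfolding distr_V ..
  \<comment> \<open>With \<open>?f\<close> written as \<open>?g\<close> composed with
    \<open>?R\<close>, the density passes to the image measure, which is Lebesgue measure
    again.\<close>
  also have "\<dots> = distr (density ?N (\<lambda>x. ?g (?R x))) ?N ?R"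
    by (simp only: gR)
  also have "\<dots> = density (distr ?N ?N ?R) ?g"
    by (rule density_distr[symmetric, OF g R])
  finally have "distr M ?N (?R \<circ> V) = density ?N ?g"
    unfolding distr_R .
  then show ?thesis
    unfolding has_ordered_beta_def distributed_def RV
    using g measurable_comp[OF measurable_V R] by blast
qed

section \<open>Moments\<close>

text \<open>A function that turns the kernel into another kernel has as expectation the quotient of
  the two normalization constants. Positivity of the new parameters gives integrability.\<close>

lemma expectation_kernel_ratio:
  assumes g: "g \<in> borel_measurable (lborel_on {1..n})"
    and ratio: "\<And>x. ordered_beta_kernel n a b 1 x * g x = ordered_beta_kernel n a' b' 1 x"
    and pos: "\<And>i. i \<in> {1..n} \<Longrightarrow> a' i > 0" "\<And>i. i \<in> {1..n} \<Longrightarrow> b' i > 0"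
  shows "integrable M (\<lambda>\<omega>. g (V \<omega>))" "(\<integral>\<omega>. g (V \<omega>) \<partial>M) = inverse C * gen_beta n a' b'"
proof -
  have nonneg: "0 \<le> inverse C * ordered_beta_kernel n a b 1 x" for x
    using C_pos by (simp add: ordered_beta_kernel_nonneg)
  have eq: "inverse C * ordered_beta_kernel n a b 1 x * g x = inverse C * ordered_beta_kernel n a' b' 1 x" for x
    by (simp only: mult.assoc ratio)
  have "integrable (lborel_on {1..n}) (ordered_beta_kernel n a' b' 1)"
    using pos by (intro nn_integral_ordered_beta_kernel(2)) auto
  then show "integrable M (\<lambda>\<omega>. g (V \<omega>))"
    unfolding distributed_integrable[OF distributed_V g nonneg, symmetric] eq
    by (rule integrable_mult_right)
  show "(\<integral>\<omega>. g (V \<omega>) \<partial>M) = inverse C * gen_beta n a' b'"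
    unfolding distributed_integral[OF distributed_V g nonneg, symmetric] eq
    by (simp add: gen_beta_def gen_inc_beta_def)
qed

text \<open>Zero exponents in a full product would leave factors such as \<open>x i powr 0\<close>,
  which vanish at 0. Isolating factor \<open>k\<close> keeps the kernel identity exact at every
  point.\<close>

lemma expectation_coordinate:
  assumes k: "k \<in> {1..n}" and "\<alpha> > - a k" "\<beta> > - b k"
  shows "integrable M (\<lambda>\<omega>. X k \<omega> powr \<alpha> * (1 - X k \<omega>) powr \<beta>)"
    "(\<integral>\<omega>. X k \<omega> powr \<alpha> * (1 - X k \<omega>) powr \<beta> \<partial>M) =
       inverse C * gen_beta n (a(k := a k + \<alpha>)) (b(k := b k + \<beta>))"
proof -
  let ?g = "\<lambda>x :: nat \<Rightarrow> real. x k powr \<alpha> * (1 - x k) powr \<beta>"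
  let ?a = "a(k := a k + \<alpha>)" and ?b = "b(k := b k + \<beta>)"
  note [measurable] = measurable_lborel_on_component[OF k]
  have g: "?g \<in> borel_measurable (lborel_on {1..n})"
    by measurable
  have ratio: "ordered_beta_kernel n a b 1 x * ?g x = ordered_beta_kernel n ?a ?b 1 x" for x
  proof -
    let ?P = "\<lambda>a b. \<Prod>i\<in>{1..n}-{k}. x i powr (a i - 1) * (1 - x i) powr (b i - 1)"
    have prod: "(\<Prod>i=1..n. x i powr (a i - 1) * (1 - x i) powr (b i - 1)) =
       x k powr (a k - 1) * (1 - x k) powr (b k - 1) * ?P a b" for a b :: "nat \<Rightarrow> real"
      using k by (intro prod.remove) auto
    have P: "?P ?a ?b = ?P a b" by (intro prod.cong) auto
    have "ordered_beta_kernel n a b 1 x * ?g x = indicator (ordered_region n 1) x *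
       ((x k powr (a k - 1) * x k powr \<alpha>) * ((1 - x k) powr (b k - 1) * (1 - x k) powr \<beta>) * ?P a b)"
      unfolding ordered_beta_kernel_def prod by (simp only: mult_ac)
    also have "\<dots> = ordered_beta_kernel n ?a ?b 1 x"
      unfolding ordered_beta_kernel_def prod P powr_diff_one_mult_powr by simp
    finally show ?thesis .
  qed
  have "integrable M (\<lambda>\<omega>. ?g (V \<omega>))" "(\<integral>\<omega>. ?g (V \<omega>) \<partial>M) = inverse C * gen_beta n ?a ?b"
    by (rule expectation_kernel_ratio[OF g ratio]; use assms a_pos b_pos in force)+
  then show "integrable M (\<lambda>\<omega>. X k \<omega> powr \<alpha> * (1 - X k \<omega>) powr \<beta>)"
    "(\<integral>\<omega>. X k \<omega> powr \<alpha> * (1 - X k \<omega>) powr \<beta> \<partial>M) = inverse C * gen_beta n ?a ?b"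
    using k by simp_all
qed

lemma expectation_prod:
  assumes "\<And>i. i \<in> {1..n} \<Longrightarrow> \<alpha> i > - a i" "\<And>i. i \<in> {1..n} \<Longrightarrow> \<beta> i > - b i"
  shows "integrable M (\<lambda>\<omega>. \<Prod>i=1..n. X i \<omega> powr \<alpha> i * (1 - X i \<omega>) powr \<beta> i)"
    "(\<integral>\<omega>. (\<Prod>i=1..n. X i \<omega> powr \<alpha> i * (1 - X i \<omega>) powr \<beta> i) \<partial>M) =
       inverse C * gen_beta n (\<lambda>i. a i + \<alpha> i) (\<lambda>i. b i + \<beta> i)"
proof -
  let ?g = "\<lambda>x :: nat \<Rightarrow> real. \<Prod>i=1..n. x i powr \<alpha> i * (1 - x i) powr \<beta> i"
  have g: "?g \<in> borel_measurable (lborel_on {1..n})"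
  proof (rule borel_measurable_prod)
    fix i assume "i \<in> {1..n}"
    note [measurable] = measurable_lborel_on_component[OF this]
    show "(\<lambda>x. x i powr \<alpha> i * (1 - x i) powr \<beta> i) \<in> borel_measurable (lborel_on {1..n})"
      by measurable
  qed
  have ratio: "ordered_beta_kernel n a b 1 x * ?g x =
      ordered_beta_kernel n (\<lambda>i. a i + \<alpha> i) (\<lambda>i. b i + \<beta> i) 1 x" for x
  proof -
    have "(\<Prod>i=1..n. x i powr (a i - 1) * (1 - x i) powr (b i - 1)) * ?g x =
      (\<Prod>i=1..n. (x i powr (a i - 1) * x i powr \<alpha> i) * ((1 - x i) powr (b i - 1) * (1 - x i) powr \<beta> i))"
      unfolding prod.distrib[symmetric] by (intro prod.cong) (simp_all only: mult_ac)
    then show ?thesis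
      unfolding ordered_beta_kernel_def powr_diff_one_mult_powr by simp
  qed
  have *: "0 < a i + \<alpha> i" "0 < b i + \<beta> i" if "i \<in> {1..n}" for i
    using assms[OF that] by simp_all
  have V: "?g (V \<omega>) = (\<Prod>i=1..n. X i \<omega> powr \<alpha> i * (1 - X i \<omega>) powr \<beta> i)" for \<omega>
    by (intro prod.cong) auto
  show "integrable M (\<lambda>\<omega>. \<Prod>i=1..n. X i \<omega> powr \<alpha> i * (1 - X i \<omega>) powr \<beta> i)"
    "(\<integral>\<omega>. (\<Prod>i=1..n. X i \<omega> powr \<alpha> i * (1 - X i \<omega>) powr \<beta> i) \<partial>M) =
       inverse C * gen_beta n (\<lambda>i. a i + \<alpha> i) (\<lambda>i. b i + \<beta> i)"
    using expectation_kernel_ratio[OF g ratio *] unfolding V by blast+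
qed

end

text \<open>Each moment formula is paired with integrability, since the integral of a non-integrable
  function would be 0 by default.\<close>

theorem theorem1:
  fixes M :: "'s measure" and n :: nat and a b :: "nat \<Rightarrow> real"
    and X :: "nat \<Rightarrow> 's \<Rightarrow> real" and C :: real
  assumes "prob_space M"
    and "n \<ge> 2"
    and "\<forall>i\<in>{1..n}. a i > 0"
    and "\<forall>i\<in>{1..n}. b i > 0"
    and "has_ordered_beta M n a b X"
    and "C = gen_beta n a b"
  shows
    "has_ordered_beta M n (rev_idx n b) (rev_idx n a) (rev_idx n (\<lambda>i \<omega>. 1 - X i \<omega>))
     \<and> (\<forall>k\<in>{1..n-1}. \<forall>z\<in>{0<..<1}.
          \<P>(\<omega> in M. X k \<omega> \<le> z \<and> z < X (k + 1) \<omega>) =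
            inverse C * gen_inc_beta k a b z
              * gen_inc_beta (n - k) (rev_idx n b) (rev_idx n a) (1 - z))
     \<and> (\<forall>k\<in>{1..n}.
          distributed M lborel (X k)
            (\<lambda>x. ennreal (indicator {0<..<1} x *
               (inverse C * x powr (a k - 1) * (1 - x) powr (b k - 1)
                 * gen_inc_beta (k - 1) a b x
                 * gen_inc_beta (n - k) (rev_idx n b) (rev_idx n a) (1 - x)))))
     \<and> (\<forall>k\<in>{1..n}. \<forall>z\<in>{0..1}.
          \<P>(\<omega> in M. X k \<omega> \<le> z) =
            (\<Sum>j=k..n. inverse C * gen_inc_beta j a b z
              * gen_inc_beta (n - j) (rev_idx n b) (rev_idx n a) (1 - z))
          \<and> \<P>(\<omega> in M. z < X k \<omega>) =
            (\<Sum>j=0..k-1. inverse C * gen_inc_beta j a b z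
              * gen_inc_beta (n - j) (rev_idx n b) (rev_idx n a) (1 - z)))
     \<and> (\<forall>k\<in>{1..n}. \<forall>\<alpha> \<beta>. \<alpha> > - a k \<and> \<beta> > - b k \<longrightarrow>
          integrable M (\<lambda>\<omega>. X k \<omega> powr \<alpha> * (1 - X k \<omega>) powr \<beta>)
          \<and> (\<integral>\<omega>. X k \<omega> powr \<alpha> * (1 - X k \<omega>) powr \<beta> \<partial>M) =
            inverse C * gen_beta n (a(k := a k + \<alpha>)) (b(k := b k + \<beta>)))
     \<and> (\<forall>\<alpha> \<beta> :: nat \<Rightarrow> real. (\<forall>i\<in>{1..n}. \<alpha> i > - a i \<and> \<beta> i > - b i) \<longrightarrow>
          integrable M (\<lambda>\<omega>. \<Prod>i=1..n. X i \<omega> powr \<alpha> i * (1 - X i \<omega>) powr \<beta> i)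
          \<and> (\<integral>\<omega>. (\<Prod>i=1..n. X i \<omega> powr \<alpha> i * (1 - X i \<omega>) powr \<beta> i) \<partial>M) =
            inverse C * gen_beta n (\<lambda>i. a i + \<alpha> i) (\<lambda>i. b i + \<beta> i))"
proof -
  interpret ordered_beta_vector M n a b X
    using assms unfolding ordered_beta_vector_def ordered_beta_vector_axioms_def by blast
  show ?thesis
    unfolding assms(6)
    using reflect_ordered_beta prob_X_between distributed_coordinate prob_X_le prob_X_gt
      expectation_coordinate expectation_prod
    by (intro conjI ballI allI impI) auto
qed

end
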